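(* For every partition $\lambda$ and positive integer $k$, there is a bijection between $\mathrm{BSSYT}(\lambda,k)$ and the set of triples $(P,i,C)$ with $P\in\mathrm{RPP}(\lambda,k)$, $1\le i\le k$, and $C$ a corner of the induced subshape $\alpha(P,i)$. That is, each barely set-valued tableau in $\mathrm{BSSYT}(\lambda,k)$ is uniquely represented by such a triple.
   Context: A partition $\lambda$ is identified with its Young diagram (square $(s,t)$ in row $s$, column $t$, rows numbered from the top). A set-valued semistandard Young tableau of shape $\lambda$ assigns a nonempty finite set of positive integers to each square such that for horizontally adjacent sets $A$ (left), $B$ (right), $\max A\le\min B$, and for vertically adjacent $A$ (above), $B$ (below), $\max A<\min B$; it is barely set-valued if exactly one square has a set of size two and all others have size one. $\mathrm{BSSYT}(\lambda,k)$ is the set of barely set-valued semistandard Young tableaux of shape $\lambda$ with every integer in row $s$ at most $k+s$. $\mathrm{RPP}(\lambda,k)$ is the set of reverse plane partitions of shape $\lambda$ with entries in $\{0,1,\dots,k\}$ (weakly increasing along rows and down columns). For $P\in\mathrm{RPP}(\lambda,k)$ and $1\le i\le k$, $\alpha(P,i)$ is the subshape (Young diagram contained in $\lambda$) consisting of the squares of $P$ with entries strictly less than $i$. A corner of a Young diagram $\mu$ is a square $(s,t)\in\mu$ with $(s+1,t)\notin\mu$ and $(s,t+1)\notin\mu$. *)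

theory Defs
  imports Main "HOL-Library.FuncSet"
begin

definition is_partition :: "nat list \<Rightarrow> bool" where
  "is_partition lam \<longleftrightarrow> sorted_wrt (\<ge>) lam \<and> (\<forall>p \<in> set lam. 0 < p)"

type_synonym square = "nat \<times> nat"

text \<open>
  Rows and columns are numbered from 1, so that row \<open>s\<close> of the diagram of \<open>lam\<close>
  consists of \<open>lam ! (s - 1)\<close> squares.
\<close>

definition diagram :: "nat list \<Rightarrow> square set" where
  "diagram lam = {(s, t). 1 \<le> s \<and> s \<le> length lam \<and> 1 \<le> t \<and> t \<le> lam ! (s - 1)}"

definition corners :: "square set \<Rightarrow> square set" where
  "corners mu = {(s, t). (s, t) \<in> mu \<and> (s + 1, t) \<notin> mu \<and> (s, t + 1) \<notin> mu}"

text \<open>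
  Fillings of a diagram are functions that take the value \<open>undefined\<close> off the diagram,
  so that two fillings are equal iff they agree on every square of the diagram.
\<close>

definition SVT :: "nat list \<Rightarrow> (square \<Rightarrow> nat set) set" where
  "SVT lam = {T \<in> diagram lam \<rightarrow>\<^sub>E {A. finite A \<and> A \<noteq> {} \<and> (\<forall>a \<in> A. 0 < a)}.
     (\<forall>s t. (s, t) \<in> diagram lam \<and> (s, t + 1) \<in> diagram lam \<longrightarrow>
        Max (T (s, t)) \<le> Min (T (s, t + 1))) \<and>
     (\<forall>s t. (s, t) \<in> diagram lam \<and> (s + 1, t) \<in> diagram lam \<longrightarrow>
        Max (T (s, t)) < Min (T (s + 1, t)))}"

definition barely_set_valued :: "nat list \<Rightarrow> (square \<Rightarrow> nat set) \<Rightarrow> bool" where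
  "barely_set_valued lam T \<longleftrightarrow>
     (\<exists>c \<in> diagram lam. card (T c) = 2 \<and> (\<forall>d \<in> diagram lam - {c}. card (T d) = 1))"

definition BSSYT :: "nat list \<Rightarrow> nat \<Rightarrow> (square \<Rightarrow> nat set) set" where
  "BSSYT lam k = {T \<in> SVT lam. barely_set_valued lam T \<and>
     (\<forall>s t. (s, t) \<in> diagram lam \<longrightarrow> (\<forall>a \<in> T (s, t). a \<le> k + s))}"

definition RPP :: "nat list \<Rightarrow> nat \<Rightarrow> (square \<Rightarrow> nat) set" where
  "RPP lam k = {P \<in> diagram lam \<rightarrow>\<^sub>E {0..k}.
     (\<forall>s t t'. (s, t) \<in> diagram lam \<and> (s, t') \<in> diagram lam \<and> t \<le> t' \<longrightarrow>
        P (s, t) \<le> P (s, t')) \<and>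
     (\<forall>s s' t. (s, t) \<in> diagram lam \<and> (s', t) \<in> diagram lam \<and> s \<le> s' \<longrightarrow>
        P (s, t) \<le> P (s', t))}"

definition subshape :: "nat list \<Rightarrow> (square \<Rightarrow> nat) \<Rightarrow> nat \<Rightarrow> square set" where
  "subshape lam P i = {c \<in> diagram lam. P c < i}"

end

theory Submission
  imports Defs
begin

text \<open>
  Replacing every set by its minimum and subtracting the row number turns a barely set-valued
  tableau into a reverse plane partition \<open>P\<close>. If \<open>C = (s, t)\<close> is the doubleton square and \<open>b\<close>
  the larger of its two entries, put \<open>i = b - s\<close>. Then \<open>P C < i\<close>, and the tableau inequalities
  between \<open>b\<close> and the squares to the right of and below \<open>C\<close> say exactly that these squares
  have \<open>P\<close>-value at least \<open>i\<close>, i.e. that \<open>C\<close> is a corner of \<open>\<alpha>(P, i)\<close>.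
\<close>

section \<open>Two-element sets and monotonicity along diagrams\<close>

lemma card_2_Min_Max:
  fixes A :: "'a::linorder set"
  assumes "card A = 2"
  shows "A = {Min A, Max A}" and "Min A < Max A"
proof -
  obtain x y where "A = {x, y}" "x \<noteq> y"
    using assms by (auto simp: card_2_iff)
  then show "A = {Min A, Max A}" and "Min A < Max A"
    by (auto simp: min_def max_def)
qed

lemma diagram_pos: "(s, t) \<in> diagram lam \<Longrightarrow> 1 \<le> s \<and> 1 \<le> t"
  by (simp add: diagram_def)

lemma diagram_left:
  assumes "(s, t') \<in> diagram lam" "1 \<le> t" "t \<le> t'"
  shows "(s, t) \<in> diagram lam"
  using assms by (simp add: diagram_def)

lemma diagram_up:
  assumes "is_partition lam" "(s', t) \<in> diagram lam" "1 \<le> s" "s \<le> s'"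
  shows "(s, t) \<in> diagram lam"
proof -
  have "lam ! (s' - 1) \<le> lam ! (s - 1)"
  proof (cases "s = s'")
    case False
    then have "s - 1 < s' - 1" "s' - 1 < length lam"
      using assms by (auto simp: diagram_def)
    then show ?thesis
      using assms(1) by (auto simp: is_partition_def sorted_wrt_iff_nth_less)
  qed simp
  then show ?thesis
    using assms by (auto simp: diagram_def)
qed

text \<open>Tableau conditions compare adjacent squares, \<open>RPP\<close> compares any two squares
  of a row. The squares in between lie in the diagram, so induction on the larger column bridges the
  gap.\<close>

lemma diagram_row_mono:
  fixes P :: "square \<Rightarrow> 'a::preorder"
  assumes step: "\<And>s t. (s, t) \<in> diagram lam \<Longrightarrow> (s, t + 1) \<in> diagram lam \<Longrightarrow>
      P (s, t) \<le> P (s, t + 1)"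
    and "(s, t) \<in> diagram lam" "(s, t') \<in> diagram lam" "t \<le> t'"
  shows "P (s, t) \<le> P (s, t')"
  using \<open>t \<le> t'\<close> \<open>(s, t') \<in> diagram lam\<close>
proof (induction t' rule: dec_induct)
  case (step n)
  have "(s, n) \<in> diagram lam"
    using step diagram_left diagram_pos[OF assms(2)] by (metis Suc_n_not_le_n le_trans nat_le_linear)
  then show ?case
    using step assms(1)[of s n] order_trans by auto
qed simp

lemma diagram_col_mono:
  fixes P :: "square \<Rightarrow> 'a::preorder"
  assumes "is_partition lam"
    and step: "\<And>s t. (s, t) \<in> diagram lam \<Longrightarrow> (s + 1, t) \<in> diagram lam \<Longrightarrow>
      P (s, t) \<le> P (s + 1, t)"
    and "(s, t) \<in> diagram lam" "(s', t) \<in> diagram lam" "s \<le> s'"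
  shows "P (s, t) \<le> P (s', t)"
  using \<open>s \<le> s'\<close> \<open>(s', t) \<in> diagram lam\<close>
proof (induction s' rule: dec_induct)
  case (step n)
  have "(n, t) \<in> diagram lam"
    using diagram_up[OF assms(1) step.prems, of n] step.hyps diagram_pos[OF assms(3)] by simp
  then show ?case
    using step assms(2)[of n t] order_trans by auto
qed simp

section \<open>Entries of set-valued tableaux\<close>

lemma SVT_D:
  assumes "T \<in> SVT lam" "c \<in> diagram lam"
  shows "finite (T c)" "T c \<noteq> {}" "\<And>a. a \<in> T c \<Longrightarrow> 0 < a"
  using assms by (auto simp: SVT_def PiE_iff)

lemma SVT_undefined:
  assumes "T \<in> SVT lam" "c \<notin> diagram lam"
  shows "T c = undefined"
proof -
  have "T \<in> diagram lam \<rightarrow>\<^sub>E {A. finite A \<and> A \<noteq> {} \<and> (\<forall>a \<in> A. 0 < a)}"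
    using assms(1) by (simp add: SVT_def)
  then show ?thesis using assms(2) by (rule PiE_arb)
qed

lemma SVT_Min_le_Max:
  assumes "T \<in> SVT lam" "c \<in> diagram lam"
  shows "Min (T c) \<le> Max (T c)"
  using SVT_D[OF assms] by simp

text \<open>Entries are positive and grow strictly down a column, whose higher squares all belong to
  the diagram. This bound makes subtracting the row number on \<open>nat\<close> exact.\<close>

lemma SVT_row_le_Min:
  assumes "is_partition lam" "T \<in> SVT lam"
  shows "(s, t) \<in> diagram lam \<Longrightarrow> s \<le> Min (T (s, t))"
proof (induction s)
  case (Suc s)
  show ?case
  proof (cases "s = 0")
    case True
    then show ?thesis
      using SVT_D[OF assms(2) Suc.prems] by (simp add: Suc_le_eq)
  next
    case False
    then have s: "(s, t) \<in> diagram lam"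
      using diagram_up[OF assms(1) Suc.prems, of s] by simp
    then have "Max (T (s, t)) < Min (T (Suc s, t))"
      using assms(2) Suc.prems by (auto simp: SVT_def)
    with Suc.IH[OF s] SVT_Min_le_Max[OF assms(2) s] show ?thesis by simp
  qed
qed simp

section \<open>From triples to tableaux\<close>

definition tableau_of :: "nat list \<Rightarrow> (square \<Rightarrow> nat) \<Rightarrow> nat \<Rightarrow> square \<Rightarrow> square \<Rightarrow> nat set" where
  "tableau_of lam P i C =
     (\<lambda>c\<in>diagram lam. if c = C then {P c + fst c, i + fst c} else {P c + fst c})"

lemma tableau_of_Min_Max:
  assumes "c \<in> diagram lam" "P C < i"
  shows "Min (tableau_of lam P i C c) = P c + fst c"
    and "Max (tableau_of lam P i C c) = (if c = C then i else P c) + fst c"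
  using assms by (auto simp: tableau_of_def)

lemma card_tableau_of:
  assumes "c \<in> diagram lam" "P C < i"
  shows "card (tableau_of lam P i C c) = (if c = C then 2 else 1)"
  using assms by (auto simp: tableau_of_def)

lemma corners_subshapeD:
  assumes "C \<in> corners (subshape lam P i)"
  shows "C \<in> diagram lam" "P C < i"
    and "(fst C, snd C + 1) \<in> diagram lam \<Longrightarrow> i \<le> P (fst C, snd C + 1)"
    and "(fst C + 1, snd C) \<in> diagram lam \<Longrightarrow> i \<le> P (fst C + 1, snd C)"
  using assms by (auto simp: corners_def subshape_def)

text \<open>The extra entry at \<open>C\<close> raises only the maximum there, as
  \<open>P C < i\<close>. Hence only the comparisons of \<open>C\<close> with its right and lower
  neighbours go beyond monotonicity of \<open>P\<close>, and the corner condition supplies them.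
  Adding row numbers makes columns strict.\<close>

lemma tableau_of_in_BSSYT:
  assumes P: "P \<in> RPP lam k" and "i \<le> k" and C: "C \<in> corners (subshape lam P i)"
  shows "tableau_of lam P i C \<in> BSSYT lam k"
proof -
  let ?T = "tableau_of lam P i C"
  note C' = corners_subshapeD[OF C]
  have row: "P (s, t) \<le> P (s, t + 1)"
    if "(s, t) \<in> diagram lam" "(s, t + 1) \<in> diagram lam" for s t
    using P that by (auto simp: RPP_def)
  have col: "P (s, t) \<le> P (s + 1, t)"
    if "(s, t) \<in> diagram lam" "(s + 1, t) \<in> diagram lam" for s t
    using P that unfolding RPP_def by (metis (no_types, lifting) le_add1 mem_Collect_eq)
  have bound: "P c \<le> k" if "c \<in> diagram lam" for c
    using P that by (auto simp: RPP_def PiE_iff)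
  have "?T \<in> diagram lam \<rightarrow>\<^sub>E {A. finite A \<and> A \<noteq> {} \<and> (\<forall>a \<in> A. 0 < a)}"
    \<comment> \<open>Positivity holds because rows are numbered from 1, even where \<open>P\<close>
      is 0.\<close>
    unfolding tableau_of_def restrict_PiE_iff by (auto simp: diagram_def)
  moreover have "Max (?T (s, t)) \<le> Min (?T (s, t + 1))"
    if "(s, t) \<in> diagram lam" "(s, t + 1) \<in> diagram lam" for s t
    using row[OF that] C' that
    by (auto simp: tableau_of_Min_Max)
  moreover have "Max (?T (s, t)) < Min (?T (s + 1, t))"
    if "(s, t) \<in> diagram lam" "(s + 1, t) \<in> diagram lam" for s t
    using col[OF that] C' that
    by (auto simp: tableau_of_Min_Max)
  ultimately have "?T \<in> SVT lam"
    unfolding SVT_def by blast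
  moreover have "barely_set_valued lam ?T"
    unfolding barely_set_valued_def using C' by (auto simp: card_tableau_of)
  moreover have "a \<le> k + s" if "(s, t) \<in> diagram lam" "a \<in> ?T (s, t)" for s t a
    using that bound[OF that(1)] \<open>i \<le> k\<close> by (auto simp: tableau_of_def split: if_splits)
  ultimately show ?thesis
    unfolding BSSYT_def by blast
qed

text \<open>The tableau determines the triple: \<open>C\<close> is its only square of cardinality 2,
  the minima give \<open>P\<close>, and the maximum at \<open>C\<close> gives
  \<open>i\<close>.\<close>

lemma tableau_of_inject:
  assumes P: "P \<in> RPP lam k" "C \<in> corners (subshape lam P i)"
    and Q: "Q \<in> RPP lam k" "D \<in> corners (subshape lam Q j)"
    and eq: "tableau_of lam P i C = tableau_of lam Q j D"
  shows "P = Q \<and> i = j \<and> C = D"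
proof -
  note C = corners_subshapeD(1,2)[OF P(2)] and D = corners_subshapeD(1,2)[OF Q(2)]
  have CD: "C = D"
    using card_tableau_of[of C lam P C i] card_tableau_of[of C lam Q D j] C D eq
    by (simp split: if_splits)
  have "P c = Q c" if "c \<in> diagram lam" for c
    using tableau_of_Min_Max(1)[of c lam P C i] tableau_of_Min_Max(1)[of c lam Q D j] C D that eq
    by simp
  moreover have "P \<in> diagram lam \<rightarrow>\<^sub>E {0..k}" "Q \<in> diagram lam \<rightarrow>\<^sub>E {0..k}"
    using P(1) Q(1) by (simp_all add: RPP_def)
  ultimately have "P = Q"
    by (metis PiE_ext)
  moreover have "i = j"
    using tableau_of_Min_Max(2)[of C lam P C i] tableau_of_Min_Max(2)[of D lam Q D j] C D CD eq
    by simp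
  ultimately show ?thesis using CD by simp
qed

section \<open>From tableaux to triples\<close>

lemma BSSYT_tableau_ofE:
  assumes lam: "is_partition lam" and T: "T \<in> BSSYT lam k"
  obtains P i C where "P \<in> RPP lam k" "1 \<le> i" "i \<le> k" "C \<in> corners (subshape lam P i)"
    "T = tableau_of lam P i C"
proof -
  have SVT: "T \<in> SVT lam" and bound: "\<And>s t a. (s, t) \<in> diagram lam \<Longrightarrow> a \<in> T (s, t) \<Longrightarrow> a \<le> k + s"
    using T by (auto simp: BSSYT_def)
  obtain C where C: "C \<in> diagram lam" "card (T C) = 2"
    and single: "\<And>d. d \<in> diagram lam \<Longrightarrow> d \<noteq> C \<Longrightarrow> card (T d) = 1"
    using T by (auto simp: BSSYT_def barely_set_valued_def)
  note TC = card_2_Min_Max[OF C(2)]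
  have row: "Max (T (s, t)) \<le> Min (T (s, t + 1))"
    if "(s, t) \<in> diagram lam" "(s, t + 1) \<in> diagram lam" for s t
    using SVT that unfolding SVT_def by blast
  have col: "Max (T (s, t)) < Min (T (s + 1, t))"
    if "(s, t) \<in> diagram lam" "(s + 1, t) \<in> diagram lam" for s t
    using SVT that unfolding SVT_def by blast
  have ge: "fst c \<le> Min (T c)" if "c \<in> diagram lam" for c
    using SVT_row_le_Min[OF lam SVT, of "fst c" "snd c"] that by simp
  have le: "Max (T c) \<le> k + fst c" if "c \<in> diagram lam" for c
    using bound[of "fst c" "snd c"] SVT_D[OF SVT that] that by simp
  note mM = SVT_Min_le_Max[OF SVT]
  define P where "P = (\<lambda>c\<in>diagram lam. Min (T c) - fst c)"
  define i where "i = Max (T C) - fst C"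
  have PC: "P c = Min (T c) - fst c" if "c \<in> diagram lam" for c
    using that by (simp add: P_def)
  have "P c \<le> k" if "c \<in> diagram lam" for c
    using PC[OF that] mM[OF that] le[OF that] by simp
  then have "P \<in> diagram lam \<rightarrow>\<^sub>E {0..k}"
    by (auto simp: P_def)
  moreover have "P (s, t) \<le> P (s, t')"
    if "(s, t) \<in> diagram lam" "(s, t') \<in> diagram lam" "t \<le> t'" for s t t'
  proof (rule diagram_row_mono[OF _ that])
    show "P (s, t) \<le> P (s, t + 1)" if "(s, t) \<in> diagram lam" "(s, t + 1) \<in> diagram lam" for s t
      using row[OF that] mM[OF that(1)] PC[OF that(1)] PC[OF that(2)] by simp
  qed
  moreover have "P (s, t) \<le> P (s', t)"
    if "(s, t) \<in> diagram lam" "(s', t) \<in> diagram lam" "s \<le> s'" for s s' t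
  proof (rule diagram_col_mono[OF lam _ that])
    show "P (s, t) \<le> P (s + 1, t)" if "(s, t) \<in> diagram lam" "(s + 1, t) \<in> diagram lam" for s t
      \<comment> \<open>The strict increase by at least 1 pays for the row number growing by
        1.\<close>
      using col[OF that] mM[OF that(1)] PC[OF that(1)] PC[OF that(2)] by simp
  qed
  ultimately have "P \<in> RPP lam k"
    unfolding RPP_def by blast
  \<comment> \<open>Truncated subtraction keeps \<open>Min (T C) < Max (T C)\<close> strict since
    \<open>fst C \<le> Min (T C)\<close>. This also yields \<open>1 \<le> i\<close>.\<close>
  moreover have less: "P C < i"
    using PC[OF C(1)] ge[OF C(1)] TC(2) by (simp add: i_def)
  moreover have "i \<le> k"
    using le[OF C(1)] by (simp add: i_def)
  moreover have "C \<in> corners (subshape lam P i)"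
  proof -
    obtain s t where st: "C = (s, t)" by fastforce
    have "i \<le> P (s, t + 1)" if "(s, t + 1) \<in> diagram lam"
      using row[of s t] C(1) PC[OF that] that by (simp add: st i_def)
    \<comment> \<open>Here \<open>Max (T C)\<close> is strictly below the next minimum, but that
      minimum is lowered by \<open>s + 1\<close> rather than \<open>s\<close>, so the bound is
      weak.\<close>
    moreover have "i \<le> P (s + 1, t)" if "(s + 1, t) \<in> diagram lam"
      using col[of s t] C(1) PC[OF that] that by (simp add: st i_def)
    ultimately show ?thesis
      using C(1) less by (auto simp: st corners_def subshape_def)
  qed
  moreover have "T = tableau_of lam P i C"
  proof
    fix c
    show "T c = tableau_of lam P i C c"
    proof (cases "c \<in> diagram lam")
      case False
      then show ?thesis
        using SVT_undefined[OF SVT] by (simp add: tableau_of_def)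
    next
      case c: True
      show ?thesis
      proof (cases "c = C")
        case True
        then show ?thesis
          using TC ge[OF c] PC[OF c] c by (simp add: tableau_of_def i_def)
      next
        case False
        then obtain a where "T c = {a}"
          using single[OF c] by (auto simp: card_1_singleton_iff)
        then show ?thesis
          using ge[OF c] PC[OF c] c False by (simp add: tableau_of_def)
      qed
    qed
  qed
  ultimately show thesis
    using that[of P i C] by simp
qed

theorem theorem3p2:
  fixes lam :: "nat list" and k :: nat
  assumes "is_partition lam" and "1 \<le> k"
  shows "\<exists>f. bij_betw f (BSSYT lam k)
    {(P, i, C). P \<in> RPP lam k \<and> 1 \<le> i \<and> i \<le> k \<and> C \<in> corners (subshape lam P i)}"
proof -
  let ?S = "{(P, i, C). P \<in> RPP lam k \<and> 1 \<le> i \<and> i \<le> k \<and> C \<in> corners (subshape lam P i)}"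
  \<comment> \<open>The explicit map runs from triples to tableaux; its inverse is the required
    bijection.\<close>
  let ?g = "\<lambda>(P, i, C). tableau_of lam P i C"
  have "inj_on ?g ?S"
    by (rule inj_onI) (auto dest: tableau_of_inject)
  moreover have "?g ` ?S = BSSYT lam k"
  proof
    show "?g ` ?S \<subseteq> BSSYT lam k"
      by (auto intro: tableau_of_in_BSSYT)
    show "BSSYT lam k \<subseteq> ?g ` ?S"
    proof
      fix T assume "T \<in> BSSYT lam k"
      with assms(1) show "T \<in> ?g ` ?S"
        by (rule BSSYT_tableau_ofE) force
    qed
  qed
  ultimately have "bij_betw ?g ?S (BSSYT lam k)"
    by (simp add: bij_betw_def)
  then show ?thesis
    using bij_betw_inv by blast
qed

end
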